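(* Let $X$ be a real Hilbert space, let $R\colon X\to X$ be linear and nonexpansive (i.e., $\|Rx-Ry\|\le\|x-y\|$ for all $x,y\in X$), and set $D:=\operatorname{Fix}R=\ker(\mathrm{Id}-R)$. Suppose that $\operatorname{ran}(\mathrm{Id}-R)$ is closed (equivalently, $\operatorname{ran}(\mathrm{Id}-R)=D^\perp$). Set $$T:=P_{D^\perp}(\mathrm{Id}-R)^{-1}P_{D^\perp}-\tfrac12P_{D^\perp}.$$ Then: (i) $\operatorname{ran}(\mathrm{Id}-R)^*=D^\perp$. (ii) $T$ is (single-valued on $X$,) linear and continuous. (iii) $T$ is monotone. (iv) $T$ is maximally monotone. (v) $\operatorname{ran}T\subseteq D^\perp$. (vi) $P_{D^\perp}T=TP_{D^\perp}=T$.
   Context: $\mathrm{Id}$ is the identity on $X$; $P_C$ is the orthogonal projection onto a closed linear subspace $C$; $(\mathrm{Id}-R)^{-1}\colon X\rightrightarrows X$ is the set-valued inverse, $(\mathrm{Id}-R)^{-1}y=\{x\in X: x-Rx=y\}$; $(\mathrm{Id}-R)^*$ is the adjoint. Compositions and sums are those of set-valued operators, so $P_{D^\perp}(\mathrm{Id}-R)^{-1}P_{D^\perp}z=\{P_{D^\perp}x: x-Rx=P_{D^\perp}z\}$, and an operator all of whose values are singletons is identified with the corresponding map. An operator $M\colon X\rightrightarrows X$ is monotone if $\langle x-y,u-v\rangle\ge0$ whenever $u\in Mx$, $v\in My$; it is maximally monotone if moreover its graph is not properly contained in the graph of another monotone operator. *)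

theory Defs
  imports "HOL-Analysis.Analysis"
begin

text \<open>
  A set-valued operator \<open>X \<rightrightarrows> X\<close> is a function into sets.  A single-valued map \<open>f\<close> is
  identified with the operator \<open>sv f\<close>.
\<close>

type_synonym 'a setop = "'a \<Rightarrow> 'a set"

definition sv :: "('a \<Rightarrow> 'a) \<Rightarrow> 'a setop" where
  "sv f = (\<lambda>x. {f x})"

definition setop_graph :: "'a setop \<Rightarrow> ('a \<times> 'a) set" where
  "setop_graph A = {(x, u). u \<in> A x}"

definition setop_range :: "'a setop \<Rightarrow> 'a set" where
  "setop_range A = (\<Union>x. A x)"

definition setop_inverse :: "'a setop \<Rightarrow> 'a setop" where
  "setop_inverse A = (\<lambda>y. {x. y \<in> A x})"

definition setop_comp :: "'a setop \<Rightarrow> 'a setop \<Rightarrow> 'a setop" (infixr \<open>\<circ>\<^sub>s\<close> 70) where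
  "A \<circ>\<^sub>s B = (\<lambda>x. \<Union>y\<in>B x. A y)"

definition setop_diff :: "'a::ab_group_add setop \<Rightarrow> 'a setop \<Rightarrow> 'a setop" (infixl \<open>-\<^sub>s\<close> 65) where
  "A -\<^sub>s B = (\<lambda>x. {u - v | u v. u \<in> A x \<and> v \<in> B x})"

definition monotone_setop :: "'a::real_inner setop \<Rightarrow> bool" where
  "monotone_setop M \<longleftrightarrow> (\<forall>x y. \<forall>u\<in>M x. \<forall>v\<in>M y. inner (x - y) (u - v) \<ge> 0)"

definition maximally_monotone_setop :: "'a::real_inner setop \<Rightarrow> bool" where
  "maximally_monotone_setop M \<longleftrightarrow>
     monotone_setop M \<and> \<not> (\<exists>N. monotone_setop N \<and> setop_graph M \<subset> setop_graph N)"

definition Fix :: "('a \<Rightarrow> 'a) \<Rightarrow> 'a set" where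
  "Fix R = {x. R x = x}"

text \<open>
  The library's \<open>closest_point\<close> requires a Heine-Borel space, hence finite dimension.  The
  description below determines a unique point when \<open>C\<close> is a closed subspace of a Hilbert space.
\<close>

definition orth_proj :: "'a::real_inner set \<Rightarrow> 'a \<Rightarrow> 'a" where
  "orth_proj C x = (THE p. p \<in> C \<and> x - p \<in> C\<^sup>\<bottom>)"

end

theory Submission
  imports Defs
begin

text \<open>
  Write \<open>A = Id - R\<close>.  A nonexpansive linear map and its adjoint have the same fixed points, since
  \<open>\<langle>S x, x\<rangle> = \<parallel>x\<parallel>\<^sup>2\<close> forces \<open>S x = x\<close> for nonexpansive \<open>S\<close>; hence
  \<open>(ran A)\<^sup>\<bottom> = D\<close>, and closedness gives \<open>ran A = D\<^sup>\<bottom>\<close>.  So \<open>A\<close> is a bijection of \<open>D\<^sup>\<bottom>\<close>.  Let \<open>B\<close>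
  be its inverse composed with \<open>P\<close>; then \<open>T = B - P / 2\<close> satisfies
  \<open>\<langle>T z, z\<rangle> = (\<parallel>x\<parallel>\<^sup>2 - \<parallel>R x\<parallel>\<^sup>2) / 2 \<ge> 0\<close> for \<open>x = B z\<close>.
  Continuity of \<open>T\<close> is not obtained from the open mapping theorem but from Baire's theorem applied
  to monotonicity: an everywhere defined monotone linear map is bounded.  Finally \<open>B\<close> is bounded and
  \<open>B A = P\<close>, so \<open>A\<^sup>* (B\<^sup>* y) = P y = y\<close> for \<open>y \<in> D\<^sup>\<bottom>\<close>, which yields \<open>ran A\<^sup>* = D\<^sup>\<bottom>\<close>.
\<close>

section \<open>Orthogonal projections and adjoints in Hilbert space\<close>

text \<open>For small t the linear term dominates, so it must vanish. This turns minimality of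
  distance into orthogonality, and monotonicity into equality in the maximality proof.\<close>

lemma quadratic_nonneg_imp_linear_coeff_zero:
  fixes a b :: real
  assumes "\<And>t. 0 \<le> t * a + t\<^sup>2 * b"
  shows "a = 0"
proof (rule ccontr)
  assume "a \<noteq> 0"
  \<comment> \<open>As k is positive and exceeds b, at t = - a / k the linear term outweighs the
    quadratic one.\<close>
  define k where "k = \<bar>b\<bar> + 1"
  have k: "k > 0" "b < k" by (auto simp: k_def)
  have "0 \<le> (- a / k) * a + (- a / k)\<^sup>2 * b" by (rule assms)
  also have "\<dots> = (a\<^sup>2 / k\<^sup>2) * (b - k)"
    using k by (simp add: field_simps power2_eq_square)
  also have "\<dots> < 0"
    using k \<open>a \<noteq> 0\<close> by (intro mult_pos_neg) auto
  finally show False by simp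
qed

lemma mem_orthogonal_comp: "x \<in> C\<^sup>\<bottom> \<longleftrightarrow> (\<forall>y\<in>C. inner x y = 0)"
  by (auto simp: orthogonal_comp_def orthogonal_def inner_commute)

lemma orthogonal_comp_Int: "x \<in> C \<Longrightarrow> x \<in> C\<^sup>\<bottom> \<Longrightarrow> x = 0"
  by (auto simp: mem_orthogonal_comp)

lemma closed_orthogonal_comp: "closed (C\<^sup>\<bottom>)"
proof -
  have "C\<^sup>\<bottom> = (\<Inter>y\<in>C. {x. inner x y = 0})"
    by (auto simp: mem_orthogonal_comp)
  moreover have "closed {x. inner x y = 0}" for y :: 'a
    by (intro closed_Collect_eq continuous_intros)
  ultimately show ?thesis by auto
qed

text \<open>A minimizing sequence for the distance to \<open>C\<close> is Cauchy by the
  parallelogram law; at its limit the first variation along every direction of \<open>C\<close>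
  vanishes.\<close>

lemma orthogonal_decomposition:
  fixes C :: "'a::{real_inner,complete_space} set"
  assumes C: "closed C" "subspace C"
  obtains p where "p \<in> C" "x - p \<in> C\<^sup>\<bottom>"
proof -
  have ne: "C \<noteq> {}" using subspace_0[OF C(2)] by auto
  define d where "d = infdist x C"
  have d0: "d \<ge> 0" by (simp add: d_def infdist_nonneg)
  have dle: "d\<^sup>2 \<le> (norm (x - y))\<^sup>2" if "y \<in> C" for y
    using infdist_le[OF that, of x] d0 unfolding d_def dist_norm by (intro power_mono)
  have "\<exists>y\<in>C. (norm (x - y))\<^sup>2 < d\<^sup>2 + 1 / Suc n" for n
  proof -
    have "d < sqrt (d\<^sup>2 + 1 / Suc n)"
      by (intro real_less_rsqrt) simp
    then obtain y where y: "y \<in> C" "dist x y < sqrt (d\<^sup>2 + 1 / Suc n)"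
      using infdist_notempty[OF ne, of x] cINF_less_iff[of C "dist x" "sqrt (d\<^sup>2 + 1 / Suc n)"] ne
      unfolding d_def by (auto intro: bdd_belowI)
    have "(norm (x - y))\<^sup>2 < (sqrt (d\<^sup>2 + 1 / Suc n))\<^sup>2"
      using y(2) unfolding dist_norm by (intro power_strict_mono) auto
    also have "\<dots> = d\<^sup>2 + 1 / Suc n" by (intro real_sqrt_pow2) simp
    finally show ?thesis using y(1) by blast
  qed
  then obtain s where s: "\<And>n. s n \<in> C" "\<And>n. (norm (x - s n))\<^sup>2 < d\<^sup>2 + 1 / Suc n"
    by metis
  have para: "(norm (s m - s n))\<^sup>2 \<le> 2 / Suc m + 2 / Suc n" for m n
  proof -
    \<comment> \<open>The midpoint stays in \<open>C\<close>, so its distance to x is at least d;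
      this is what the parallelogram law needs to make the difference small.\<close>
    have "(1/2) *\<^sub>R (s m + s n) \<in> C"
      using s(1) C(2) by (simp add: subspace_add subspace_scale)
    from dle[OF this] have "4 * d\<^sup>2 \<le> (norm (2 *\<^sub>R (x - (1/2) *\<^sub>R (s m + s n))))\<^sup>2"
      by (simp add: power_mult_distrib)
    also have "\<dots> = 2 * (norm (x - s m))\<^sup>2 + 2 * (norm (x - s n))\<^sup>2 - (norm (s m - s n))\<^sup>2"
      unfolding power2_norm_eq_inner
      by (simp add: inner_simps inner_commute algebra_simps)
    finally show ?thesis using s(2)[of m] s(2)[of n] by simp
  qed
  have "Cauchy s"
    unfolding Cauchy_altdef2
  proof (intro allI impI)
    fix e :: real assume "e > 0"
    obtain N where N: "N > 0" "inverse (of_nat N) < e\<^sup>2 / 4"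
      using ex_inverse_of_nat_less[of "e\<^sup>2 / 4"] \<open>e > 0\<close> by auto
    have "dist (s n) (s N) < e" if "n \<ge> N" for n
    proof -
      have "2 / real (Suc n) \<le> 2 / N" "2 / real (Suc N) \<le> 2 / N"
        using that N by (auto intro!: divide_left_mono)
      then have "(norm (s n - s N))\<^sup>2 \<le> 4 * inverse (real N)"
        using para[of n N] unfolding inverse_eq_divide by linarith
      then have "(norm (s n - s N))\<^sup>2 < e\<^sup>2"
        using N(2) by linarith
      then show ?thesis
        unfolding dist_norm by (rule power_less_imp_less_base) (simp add: \<open>e > 0\<close> less_imp_le)
    qed
    then show "\<exists>N. \<forall>n\<ge>N. dist (s n) (s N) < e" by blast
  qed
  then obtain p where p: "s \<longlonglongrightarrow> p"
    using Cauchy_convergent convergentD by blast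
  have pC: "p \<in> C"
    using closed_sequentially[OF C(1) _ p] s(1) by blast
  have "(\<lambda>n. (norm (x - s n))\<^sup>2) \<longlonglongrightarrow> (norm (x - p))\<^sup>2"
    by (intro tendsto_intros p)
  moreover have "(\<lambda>n. d\<^sup>2 + 1 / real (Suc n)) \<longlonglongrightarrow> d\<^sup>2 + 0"
    using LIMSEQ_inverse_real_of_nat by (intro tendsto_intros) (simp add: inverse_eq_divide)
  ultimately have pmin: "(norm (x - p))\<^sup>2 \<le> d\<^sup>2"
    using s(2) by (intro LIMSEQ_le[of "\<lambda>n. (norm (x - s n))\<^sup>2" _ "\<lambda>n. d\<^sup>2 + 1 / real (Suc n)"])
      (auto intro!: exI[of _ 0] less_imp_le)
  have "inner (x - p) y = 0" if "y \<in> C" for y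
  proof -
    have "0 \<le> t * (2 * inner (x - p) y) + t\<^sup>2 * inner y y" for t
    proof -
      have "p - t *\<^sub>R y \<in> C"
        using that pC C(2) by (simp add: subspace_diff subspace_scale)
      from dle[OF this] pmin have "(norm (x - p))\<^sup>2 \<le> (norm ((x - p) + t *\<^sub>R y))\<^sup>2"
        unfolding diff_diff_eq2 add_diff_eq diff_add_eq by linarith
      then show ?thesis
        unfolding power2_norm_eq_inner inner_add_left inner_add_right inner_scaleR_left
          inner_scaleR_right inner_commute[of y "x - p"]
        by (simp add: power2_eq_square algebra_simps)
    qed
    from quadratic_nonneg_imp_linear_coeff_zero[OF this] show ?thesis by simp
  qed
  then show thesis
    using that pC by (auto simp: mem_orthogonal_comp)
qed

text \<open>For x in the double complement, the residual of its projection lies in both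
  \<open>C\<^sup>\<bottom>\<close> and \<open>C\<^sup>\<bottom>\<^sup>\<bottom>\<close>, hence is
  0.\<close>

lemma orthogonal_comp_twice_closed:
  fixes C :: "'a::{real_inner,complete_space} set"
  assumes C: "closed C" "subspace C"
  shows "C\<^sup>\<bottom>\<^sup>\<bottom> = C"
proof
  show "C\<^sup>\<bottom>\<^sup>\<bottom> \<subseteq> C"
  proof
    fix x assume x: "x \<in> C\<^sup>\<bottom>\<^sup>\<bottom>"
    obtain p where p: "p \<in> C" "x - p \<in> C\<^sup>\<bottom>"
      using orthogonal_decomposition[OF C] .
    have "x - p \<in> C\<^sup>\<bottom>\<^sup>\<bottom>"
      using x p(1) orthogonal_comp_subset[of C] subspace_orthogonal_comp by (blast intro: subspace_diff)
    then have "x - p = 0" using p(2) orthogonal_comp_Int by blast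
    then show "x \<in> C" using p(1) by simp
  qed
qed (rule orthogonal_comp_subset)

lemma orth_proj_eqI:
  assumes "subspace C" "p \<in> C" "x - p \<in> C\<^sup>\<bottom>"
  shows "orth_proj C x = p"
  unfolding orth_proj_def
proof (rule the_equality)
  fix q assume q: "q \<in> C \<and> x - q \<in> C\<^sup>\<bottom>"
  have "p - q \<in> C" using assms q by (blast intro: subspace_diff)
  moreover have "(x - q) - (x - p) \<in> C\<^sup>\<bottom>"
    using assms q subspace_orthogonal_comp by (blast intro: subspace_diff)
  ultimately show "q = p"
    using orthogonal_comp_Int[of "p - q" C] by simp
qed (use assms in blast)

lemma
  fixes C :: "'a::{real_inner,complete_space} set"
  assumes C: "closed C" "subspace C"
  shows orth_proj_mem: "orth_proj C x \<in> C"
    and orth_proj_diff_mem: "x - orth_proj C x \<in> C\<^sup>\<bottom>"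
proof -
  obtain p where p: "p \<in> C" "x - p \<in> C\<^sup>\<bottom>"
    using orthogonal_decomposition[OF C] .
  then have "orth_proj C x = p" using C by (blast intro: orth_proj_eqI)
  with p show "orth_proj C x \<in> C" "x - orth_proj C x \<in> C\<^sup>\<bottom>" by auto
qed

lemma orth_proj_id: "subspace C \<Longrightarrow> x \<in> C \<Longrightarrow> orth_proj C x = x"
  by (rule orth_proj_eqI) (auto simp: mem_orthogonal_comp)

lemma inner_orth_proj_right:
  fixes C :: "'a::{real_inner,complete_space} set"
  assumes C: "closed C" "subspace C" and "y \<in> C"
  shows "inner y (orth_proj C x) = inner y x"
  using orth_proj_diff_mem[OF C, of x] \<open>y \<in> C\<close>
  by (simp add: mem_orthogonal_comp inner_diff_left inner_commute[of y])

lemma bounded_linear_orth_proj: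
  fixes C :: "'a::{real_inner,complete_space} set"
  assumes C: "closed C" "subspace C"
  shows "bounded_linear (orth_proj C)"
proof (rule bounded_linear_intro[where K = 1])
  note mem = orth_proj_mem[OF C] orth_proj_diff_mem[OF C]
  fix x y :: 'a and r :: real
  have "x + y - (orth_proj C x + orth_proj C y) \<in> C\<^sup>\<bottom>"
    using subspace_add[OF subspace_orthogonal_comp mem(2)[of x] mem(2)[of y]]
    by (simp add: algebra_simps)
  then show "orth_proj C (x + y) = orth_proj C x + orth_proj C y"
    using C mem(1) by (intro orth_proj_eqI) (auto intro: subspace_add)
  have "r *\<^sub>R x - r *\<^sub>R orth_proj C x \<in> C\<^sup>\<bottom>"
    using subspace_scale[OF subspace_orthogonal_comp mem(2)[of x], of r]
    by (simp add: algebra_simps)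
  then show "orth_proj C (r *\<^sub>R x) = r *\<^sub>R orth_proj C x"
    using C mem(1) by (intro orth_proj_eqI) (auto intro: subspace_scale)
  have "norm (orth_proj C x) * norm (orth_proj C x) = inner (orth_proj C x) x"
    using inner_orth_proj_right[OF C mem(1), of x x]
    by (simp only: power2_norm_eq_inner flip: power2_eq_square)
  also have "\<dots> \<le> norm (orth_proj C x) * norm x" by (rule norm_cauchy_schwarz)
  finally show "norm (orth_proj C x) \<le> norm x * 1"
    by (cases "norm (orth_proj C x) = 0") (auto simp: mult_le_cancel_left)
qed

text \<open>The component q of x0 orthogonal to the kernel is nonzero, and subtracting (f x / f q) q
  from x lands in the kernel; so f is a multiple of the inner product with q.\<close>

lemma riesz_representation:
  fixes f :: "'a::{real_inner,complete_space} \<Rightarrow> real"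
  assumes f: "bounded_linear f"
  obtains u where "\<And>x. f x = inner x u"
proof (cases "\<forall>x. f x = 0")
  case True
  then show thesis using that[of 0] by simp
next
  case False
  then obtain x0 where x0: "f x0 \<noteq> 0" by blast
  interpret f: bounded_linear f by fact
  let ?K = "{x. f x = 0}"
  have "closed ?K"
    by (intro closed_Collect_eq continuous_intros f.continuous_on)
  moreover have "subspace ?K"
    by (simp add: subspace_def f.add f.scaleR f.zero)
  ultimately obtain p where p: "p \<in> ?K" "x0 - p \<in> ?K\<^sup>\<bottom>"
    using orthogonal_decomposition by blast
  define q where "q = x0 - p"
  have fq: "f q \<noteq> 0" using x0 p(1) by (simp add: q_def f.diff)
  then have q: "inner q q \<noteq> 0" using f.zero by auto
  have "f x = inner x ((f q / inner q q) *\<^sub>R q)" for x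
  proof -
    have "x - (f x / f q) *\<^sub>R q \<in> ?K"
      using fq by (simp add: f.diff f.scaleR)
    then have "inner q (x - (f x / f q) *\<^sub>R q) = 0"
      using p(2) unfolding q_def mem_orthogonal_comp by blast
    then have "inner x q = f x / f q * inner q q"
      by (simp add: inner_diff_right inner_commute)
    then show ?thesis using fq q by simp
  qed
  then show thesis by (rule that)
qed

text \<open>\<open>adjoint\<close> is a choice operator, so its defining identity holds only once
  some adjoint exists; Riesz representation supplies one, separately for each y.\<close>

lemma adjoint_bounded_linear_works:
  fixes f :: "'a::{real_inner,complete_space} \<Rightarrow> 'b::real_inner"
  assumes f: "bounded_linear f"
  shows "inner x (adjoint f y) = inner (f x) y"
proof -
  have "\<exists>u. \<forall>x. inner (f x) y = inner x u" for y
    using riesz_representation[OF bounded_linear_compose[OF bounded_linear_inner_left f]]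
    by metis
  then obtain g where "\<forall>x y. inner (f x) y = inner x (g y)" by metis
  moreover from this have "adjoint f = g" by (rule adjoint_unique)
  ultimately show ?thesis by simp
qed

section \<open>Monotone linear operators\<close>

text \<open>
  On \<open>S = {x. \<parallel>x\<parallel> \<le> 1 \<and> \<parallel>x\<parallel> \<parallel>f x\<parallel> \<le> 1}\<close>, monotonicity bounds \<open>\<langle>f x, z\<rangle>\<close> for every fixed \<open>z\<close>;
  uniform boundedness then bounds \<open>f\<close> on \<open>S\<close>, and every vector can be scaled into \<open>S\<close>.
\<close>

lemma monotone_linear_imp_bounded_linear:
  fixes f :: "'a::{real_inner,complete_space} \<Rightarrow> 'a"
  assumes f: "linear f" and mono: "\<And>x. 0 \<le> inner (f x) x"
  shows "bounded_linear f"
proof -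
  interpret f: linear f by fact
  define S where "S = {x. norm x \<le> 1 \<and> norm x * norm (f x) \<le> 1}"
  define F where "F = (\<lambda>n::nat. {z. \<forall>x\<in>S. \<bar>inner (f x) z\<bar> \<le> real n})"
  have closedF: "closed (F n)" for n
  proof -
    have "F n = (\<Inter>x\<in>S. {z. \<bar>inner (f x) z\<bar> \<le> real n})" by (auto simp: F_def)
    moreover have "closed {z. \<bar>inner (f x) z\<bar> \<le> real n}" for x
      by (intro closed_Collect_le continuous_intros)
    ultimately show ?thesis by auto
  qed
  \<comment> \<open>Expand monotonicity at z - x; membership in \<open>S\<close> controls the two
    terms that still involve x.\<close>
  have upper: "inner (f x) z \<le> inner (f z) z + 1 + norm (f z)" if "x \<in> S" for x z
  proof -
    have "0 \<le> inner (f (z - x)) (z - x)" by (rule mono)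
    then have "inner (f x) z \<le> inner (f z) z - inner (f z) x + inner (f x) x"
      by (simp add: f.diff inner_diff_left inner_diff_right)
    moreover have "inner (f x) x \<le> 1"
      using norm_cauchy_schwarz[of "f x" x] that by (simp add: S_def mult.commute)
    moreover have "- inner (f z) x \<le> norm (f z)"
    proof -
      have "- inner (f z) x \<le> norm (f z) * norm x"
        using Cauchy_Schwarz_ineq2[of "f z" x] by linarith
      also have "\<dots> \<le> norm (f z)"
        using that by (intro mult_left_le) (auto simp: S_def)
      finally show ?thesis .
    qed
    ultimately show ?thesis by linarith
  qed
  have cover: "(\<Union>n. F n) = UNIV"
  proof -
    have "\<exists>n. z \<in> F n" for z
    proof -
      obtain n :: nat where n: "inner (f z) z + 1 + norm (f z) \<le> real n"
        using real_arch_simple by blast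
      have "\<bar>inner (f x) z\<bar> \<le> real n" if "x \<in> S" for x
        \<comment> \<open>The quadratic term agrees at z and - z, so the two one-sided bounds give
          the absolute value.\<close>
        using upper[OF that, of z] upper[OF that, of "- z"] n by (simp add: f.neg)
      then show ?thesis by (auto simp: F_def)
    qed
    then show ?thesis by auto
  qed
  have "\<exists>n. interior (F n) \<noteq> {}"
  proof (rule ccontr)
    assume "\<not> ?thesis"
    then have "euclidean interior_of \<Union>(range F) = {}"
      using closedF
      by (intro Baire_category_alt) (auto simp: completely_metrizable_space_euclidean)
    then show False using cover by simp
  qed
  then obtain n z0 e where e: "e > 0" "cball z0 e \<subseteq> F n"
    by (meson ex_in_conv mem_interior_cball)
  \<comment> \<open>The bounds at z0 and at z0 + w are subtracted, where w has length e and points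
    along f x.\<close>
  define K where "K = 2 * real n / e"
  have K0: "K \<ge> 0" using e by (simp add: K_def)
  have S_bound: "norm (f x) \<le> K" if "x \<in> S" for x
  proof (cases "f x = 0")
    case False
    define w where "w = (e / norm (f x)) *\<^sub>R f x"
    have "norm w = e" using e False by (simp add: w_def)
    then have "z0 + w \<in> F n" "z0 \<in> F n"
      using e by (auto simp: dist_norm subset_iff)
    then have "\<bar>inner (f x) (z0 + w)\<bar> \<le> real n" "\<bar>inner (f x) z0\<bar> \<le> real n"
      using that by (auto simp: F_def)
    then have "inner (f x) w \<le> 2 * real n" by (simp add: inner_add_right)
    moreover have "inner (f x) w = e * norm (f x)"
      using False by (simp add: w_def power2_norm_eq_inner[symmetric] power2_eq_square)
    ultimately show ?thesis using e by (simp add: K_def field_simps)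
  qed (simp add: K0)
  \<comment> \<open>Two scalings into \<open>S\<close>: if f does not lengthen x, normalizing x
    gives the factor K; otherwise t is chosen so that the product of the norms of t x and f (t x) is
    1, which gives K squared.\<close>
  have "norm (f x) \<le> norm x * (K + K\<^sup>2)" for x
  proof (cases "norm x = 0")
    case False
    then have x: "norm x > 0" by simp
    show ?thesis
    proof (cases "norm (f x) \<le> norm x")
      case True
      have "(1 / norm x) *\<^sub>R x \<in> S"
        using x True by (simp add: S_def f.scaleR)
      from S_bound[OF this] have "norm (f x) \<le> norm x * K"
        using x by (simp add: f.scaleR field_simps)
      also have "\<dots> \<le> norm x * (K + K\<^sup>2)" by (intro mult_left_mono) auto
      finally show ?thesis .
    next
      case False
      define t where "t = 1 / sqrt (norm x * norm (f x))"
      have fx: "norm (f x) > 0" using False x by linarith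
      have t: "t > 0" "t\<^sup>2 * (norm x * norm (f x)) = 1"
        using x fx by (auto simp: t_def power_divide)
      have "(t * norm x)\<^sup>2 \<le> t\<^sup>2 * (norm x * norm (f x))"
        unfolding power_mult_distrib power2_eq_square[of "norm x"]
        using False by (intro mult_left_mono) auto
      then have "t * norm x \<le> 1"
        using t abs_square_le_1[of "t * norm x"] by simp
      moreover have "t * norm x * (t * norm (f x)) \<le> 1"
        using t by (simp add: power2_eq_square mult_ac)
      ultimately have "t *\<^sub>R x \<in> S"
        using t by (simp add: S_def f.scaleR)
      from S_bound[OF this] have "t * norm (f x) \<le> K"
        using t by (simp add: f.scaleR)
      then have "(t * norm (f x))\<^sup>2 \<le> K\<^sup>2"
        using t by (intro power_mono) auto
      moreover have "(t * norm (f x))\<^sup>2 * norm x = norm (f x) * (t\<^sup>2 * (norm x * norm (f x)))"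
        by (simp add: power2_eq_square mult_ac)
      ultimately have "norm (f x) \<le> K\<^sup>2 * norm x"
        using t x by (metis mult.right_neutral mult_right_mono norm_ge_zero)
      also have "\<dots> \<le> norm x * (K + K\<^sup>2)" using K0 x by (simp add: algebra_simps)
      finally show ?thesis .
    qed
  qed (simp add: f.zero)
  then show ?thesis
    by (intro bounded_linear_intro[of f "K + K\<^sup>2"] f.add f.scaleR)
qed

lemma monotone_sv_linear:
  assumes f: "linear f" and mono: "\<And>x. 0 \<le> inner (f x) x"
  shows "monotone_setop (sv f)"
  using mono by (auto simp: monotone_setop_def sv_def linear_diff[OF f, symmetric] inner_commute)

text \<open>A pair (x, u) of a monotone extension is tested against the graph points over x - t w.
  The coefficient linear in t must vanish for every w, which forces u = f x.\<close>

lemma maximally_monotone_sv_linear: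
  assumes f: "linear f" and mono: "\<And>x. 0 \<le> inner (f x) x"
  shows "maximally_monotone_setop (sv f)"
proof -
  interpret f: linear f by fact
  have "setop_graph N \<subseteq> setop_graph (sv f)"
    if N: "monotone_setop N" "setop_graph (sv f) \<subseteq> setop_graph N" for N
  proof clarify
    fix x u assume "(x, u) \<in> setop_graph N"
    then have u: "u \<in> N x" by (simp add: setop_graph_def)
    have fN: "f y \<in> N y" for y
      using N(2) by (auto simp: setop_graph_def sv_def)
    have "inner w (u - f x) = 0" for w
    proof (rule quadratic_nonneg_imp_linear_coeff_zero)
      fix t :: real
      have "0 \<le> inner (x - (x - t *\<^sub>R w)) (u - f (x - t *\<^sub>R w))"
        using N(1) u fN unfolding monotone_setop_def by blast
      also have "\<dots> = t * inner w (u - f x) + t\<^sup>2 * inner w (f w)"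
        by (simp add: f.diff f.scaleR inner_diff_right inner_add_right power2_eq_square algebra_simps)
      finally show "0 \<le> t * inner w (u - f x) + t\<^sup>2 * inner w (f w)" .
    qed
    then have "u - f x = 0" by (metis inner_eq_zero_iff)
    then show "(x, u) \<in> setop_graph (sv f)" by (simp add: setop_graph_def sv_def)
  qed
  then show ?thesis
    using monotone_sv_linear[OF f mono] by (auto simp: maximally_monotone_setop_def)
qed

section \<open>Linear nonexpansive maps\<close>

text \<open>This is the equality case of Cauchy-Schwarz. It is applied to both R and its
  adjoint.\<close>

lemma nonexpansive_fixed_pointI:
  fixes y x :: "'a::real_inner"
  assumes "norm y \<le> norm x" "inner y x = (norm x)\<^sup>2"
  shows "y = x"
proof -
  have "(norm (y - x))\<^sup>2 = (norm y)\<^sup>2 - 2 * inner y x + (norm x)\<^sup>2"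
    unfolding power2_norm_eq_inner by (simp add: inner_diff_left inner_diff_right inner_commute)
  also have "\<dots> \<le> 0"
    using assms power_mono[OF assms(1), of 2] by simp
  finally show ?thesis by simp
qed

locale linear_nonexpansive =
  fixes R :: "'a::{real_inner,complete_space} \<Rightarrow> 'a"
  assumes lin: "linear R" and norm_le: "norm (R x) \<le> norm x"
begin

abbreviation A where "A \<equiv> \<lambda>x. x - R x"
abbreviation D where "D \<equiv> Fix R"
abbreviation P where "P \<equiv> orth_proj (D\<^sup>\<bottom>)"

lemma bounded_linear_R: "bounded_linear R"
  by (rule bounded_linear_intro[of R 1]) (simp_all add: linear_add[OF lin] linear_scale[OF lin] norm_le)

lemma bounded_linear_A: "bounded_linear A"
  by (intro bounded_linear_sub bounded_linear_ident bounded_linear_R)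

sublocale A: bounded_linear A
  by (rule bounded_linear_A)

lemma mem_D: "x \<in> D \<longleftrightarrow> A x = 0"
  by (auto simp: Fix_def)

lemma closed_D: "closed D"
  unfolding Fix_def
  by (intro closed_Collect_eq linear_continuous_on bounded_linear_R continuous_on_id)

lemma subspace_D: "subspace D"
  by (simp add: subspace_def Fix_def linear_0[OF lin] linear_add[OF lin] linear_scale[OF lin])

text \<open>The adjoint of R is nonexpansive too, and its inner product with a fixed vector d shows
  that it fixes d. Moving R across the inner product then cancels the two terms.\<close>

lemma range_A_subset: "range A \<subseteq> D\<^sup>\<bottom>"
proof -
  have "inner (A x) d = 0" if "d \<in> D" for x d
  proof -
    note adj = adjoint_bounded_linear_works[OF bounded_linear_R]
    have "adjoint R d = d"
    proof (rule nonexpansive_fixed_pointI)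
      have "norm (adjoint R d) * norm (adjoint R d) = inner (R (adjoint R d)) d"
        using adj[of "adjoint R d" d] by (simp only: power2_norm_eq_inner flip: power2_eq_square)
      also have "\<dots> \<le> norm (R (adjoint R d)) * norm d" by (rule norm_cauchy_schwarz)
      also have "\<dots> \<le> norm (adjoint R d) * norm d" by (intro mult_right_mono norm_le) simp
      finally show "norm (adjoint R d) \<le> norm d"
        by (cases "norm (adjoint R d) = 0") (auto simp: mult_le_cancel_left)
      show "inner (adjoint R d) d = (norm d)\<^sup>2"
        using that adj[of d d] by (simp add: Fix_def inner_commute power2_norm_eq_inner)
    qed
    then show ?thesis using adj[of x d] by (simp add: inner_diff_left)
  qed
  then show ?thesis by (auto simp: mem_orthogonal_comp)
qed

text \<open>The residual q of projecting y onto the range is orthogonal to A q in particular, so q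
  is fixed by R; being also in \<open>D\<^sup>\<bottom>\<close>, it is 0.\<close>

lemma closed_range_iff: "closed (range A) \<longleftrightarrow> range A = D\<^sup>\<bottom>"
proof
  assume cl: "closed (range A)"
  have sub: "subspace (range A)"
    using linear_subspace_image[OF A.linear subspace_UNIV] .
  have "D\<^sup>\<bottom> \<subseteq> range A"
  proof
    fix y assume y: "y \<in> D\<^sup>\<bottom>"
    obtain p where p: "p \<in> range A" "y - p \<in> (range A)\<^sup>\<bottom>"
      using orthogonal_decomposition[OF cl sub] .
    define q where "q = y - p"
    have "inner q (A q) = 0" using p(2) unfolding q_def mem_orthogonal_comp by blast
    then have "inner (R q) q = (norm q)\<^sup>2"
      by (simp add: inner_diff_right inner_commute power2_norm_eq_inner)
    then have "R q = q" by (rule nonexpansive_fixed_pointI[OF norm_le])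
    then have "q \<in> D" by (simp add: Fix_def)
    moreover have "q \<in> D\<^sup>\<bottom>"
      unfolding q_def
      using p(1) range_A_subset by (intro subspace_diff subspace_orthogonal_comp y) blast
    ultimately have "q = 0" by (rule orthogonal_comp_Int)
    then show "y \<in> range A" using p(1) by (simp add: q_def)
  qed
  then show "range A = D\<^sup>\<bottom>" using range_A_subset by blast
next
  assume "range A = D\<^sup>\<bottom>"
  then show "closed (range A)" by (simp only: closed_orthogonal_comp)
qed

lemmas P_mem = orth_proj_mem[OF closed_orthogonal_comp subspace_orthogonal_comp, of D]
lemmas P_id = orth_proj_id[OF subspace_orthogonal_comp, of _ D]
lemmas inner_P = inner_orth_proj_right[OF closed_orthogonal_comp subspace_orthogonal_comp, of _ D]
lemmas bounded_linear_P = bounded_linear_orth_proj[OF closed_orthogonal_comp subspace_orthogonal_comp, of D]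

sublocale P: bounded_linear P
  by (rule bounded_linear_P)

text \<open>The residual x - P x lies in the double complement of \<open>D\<close>, which is
  \<open>D\<close> itself.\<close>

lemma A_P: "A (P x) = A x"
proof -
  have "x - P x \<in> D"
    using orth_proj_diff_mem[OF closed_orthogonal_comp subspace_orthogonal_comp, of x D]
    by (simp add: orthogonal_comp_twice_closed[OF closed_D subspace_D])
  then show ?thesis using A.diff[of x "P x"] by (simp only: mem_D) simp
qed

lemma inj_on_A: "inj_on A (D\<^sup>\<bottom>)"
proof (rule inj_onI)
  fix x y assume xy: "x \<in> D\<^sup>\<bottom>" "y \<in> D\<^sup>\<bottom>" "A x = A y"
  have "A (x - y) = 0" unfolding A.diff xy(3) by (rule diff_self)
  then have "x - y \<in> D" unfolding mem_D .
  moreover have "x - y \<in> D\<^sup>\<bottom>" using xy by (intro subspace_diff subspace_orthogonal_comp)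
  ultimately have "x - y = 0" by (rule orthogonal_comp_Int)
  then show "x = y" by simp
qed

end

section \<open>The inverse of Id - R on \<open>D\<^sup>\<bottom>\<close> and the operator T\<close>

locale linear_nonexpansive_closed_range = linear_nonexpansive +
  assumes range_A: "range A = D\<^sup>\<bottom>"
begin

text \<open>This is the Moore-Penrose inverse of \<open>A\<close>. The choice is unique by
  \<open>inj_on_A\<close>.\<close>

definition B where "B z = (SOME x. x \<in> D\<^sup>\<bottom> \<and> A x = P z)"

lemma B_mem: "B z \<in> D\<^sup>\<bottom>" and A_B: "A (B z) = P z"
proof -
  obtain x where "A x = P z" using P_mem[of z] range_A by (metis imageE)
  \<comment> \<open>Projecting a preimage moves it into \<open>D\<^sup>\<bottom>\<close> without
    changing its image.\<close>
  then have "\<exists>x. x \<in> D\<^sup>\<bottom> \<and> A x = P z" using P_mem A_P by metis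
  from someI_ex[OF this] show "B z \<in> D\<^sup>\<bottom>" "A (B z) = P z" by (auto simp: B_def)
qed

lemma B_eqI: "x \<in> D\<^sup>\<bottom> \<Longrightarrow> A x = P z \<Longrightarrow> B z = x"
  by (rule inj_onD[OF inj_on_A _ B_mem]) (simp_all only: A_B)

lemma B_P: "B (P z) = B z"
  by (intro B_eqI B_mem) (simp only: A_B P_id[OF P_mem])

lemma B_A: "B (A x) = P x"
proof (rule B_eqI[OF P_mem])
  have "A x \<in> D\<^sup>\<bottom>" using range_A_subset by blast
  then show "A (P x) = P (A x)" by (simp only: A_P P_id)
qed

lemma linear_B: "linear B"
proof (rule linearI)
  fix x y :: 'a and r :: real
  show "B (x + y) = B x + B y"
  proof (rule B_eqI)
    show "B x + B y \<in> D\<^sup>\<bottom>" by (intro subspace_add subspace_orthogonal_comp B_mem)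
    show "A (B x + B y) = P (x + y)" by (simp only: A.add A_B P.add)
  qed
  show "B (r *\<^sub>R x) = r *\<^sub>R B x"
  proof (rule B_eqI)
    show "r *\<^sub>R B x \<in> D\<^sup>\<bottom>" by (intro subspace_scale subspace_orthogonal_comp B_mem)
    show "A (r *\<^sub>R B x) = P (r *\<^sub>R x)" by (simp only: A.scaleR A_B P.scaleR)
  qed
qed

definition L where "L z = B z - (1/2) *\<^sub>R P z"

lemma linear_L: "linear L"
  unfolding L_def[abs_def] by (intro linear_compose_sub linear_B linear_compose_scale_right P.linear)

lemma L_mem: "L z \<in> D\<^sup>\<bottom>"
  unfolding L_def
  by (intro subspace_diff subspace_scale subspace_orthogonal_comp B_mem P_mem)

lemma L_monotone: "0 \<le> inner (L z) z"
proof -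
  define x where "x = B z"
  have Pz: "P z = A x" unfolding x_def by (rule A_B[symmetric])
  have "inner (L z) z = inner (L z) (P z)"
    by (rule inner_P[OF L_mem, symmetric])
  \<comment> \<open>Subtracting half of P is exactly what cancels the cross terms between x and R x,
    leaving a difference of squares.\<close>
  also have "\<dots> = inner x (A x) - (1/2) * inner (A x) (A x)"
    by (simp only: L_def inner_diff_left[of x "(1/2) *\<^sub>R A x"] inner_scaleR_left Pz flip: x_def)
  also have "\<dots> = ((norm x)\<^sup>2 - (norm (R x))\<^sup>2) / 2"
    unfolding power2_norm_eq_inner
    by (simp add: inner_diff_left inner_diff_right inner_commute field_simps)
  also have "\<dots> \<ge> 0"
    using power_mono[OF norm_le, of x 2] by simp
  finally show ?thesis .
qed

lemma bounded_linear_L: "bounded_linear L"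
  by (rule monotone_linear_imp_bounded_linear[OF linear_L L_monotone])

text \<open>Boundedness passes from \<open>L\<close> to \<open>B\<close>, not conversely:
  monotonicity has already made \<open>L\<close> bounded, and \<open>B\<close> is \<open>L\<close>
  plus half of \<open>P\<close>.\<close>

lemma bounded_linear_B: "bounded_linear B"
proof -
  have "bounded_linear (\<lambda>z. L z + (1/2) *\<^sub>R P z)"
    by (intro bounded_linear_add bounded_linear_L bounded_linear_const_scaleR bounded_linear_P)
  then show ?thesis unfolding L_def diff_add_cancel .
qed

text \<open>Taking adjoints in \<open>B_A\<close> makes \<open>adjoint B y\<close> an explicit
  preimage of y; the bound on \<open>B\<close> is what gives access to its adjoint.\<close>

lemma range_adjoint_A: "range (adjoint A) = D\<^sup>\<bottom>"
proof
  note adjA = adjoint_bounded_linear_works[OF bounded_linear_A]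
  note adjB = adjoint_bounded_linear_works[OF bounded_linear_B]
  show "range (adjoint A) \<subseteq> D\<^sup>\<bottom>"
  proof clarify
    fix y
    have "inner (adjoint A y) d = 0" if "d \<in> D" for d
      using that adjA[of d y] by (simp only: mem_D inner_commute[of _ d] inner_zero_left)
    then show "adjoint A y \<in> D\<^sup>\<bottom>" by (simp add: mem_orthogonal_comp)
  qed
  show "D\<^sup>\<bottom> \<subseteq> range (adjoint A)"
  proof
    fix y assume y: "y \<in> D\<^sup>\<bottom>"
    have "inner x (adjoint A (adjoint B y)) = inner x y" for x
    proof -
      have "inner x (adjoint A (adjoint B y)) = inner (P x) y"
        by (simp only: adjA adjB B_A)
      also have "\<dots> = inner x y"
        using inner_P[OF y, of x] by (simp only: inner_commute)
      finally show ?thesis .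
    qed
    then have "adjoint A (adjoint B y) = y"
      using vector_eq_ldot by blast
    then show "y \<in> range (adjoint A)" by (metis rangeI)
  qed
qed

text \<open>The solutions x of A x = P z form a coset of \<open>D\<close>, which the outer
  projection collapses to the single point \<open>B z\<close>.\<close>

lemma setop_eq_L:
  "(sv P \<circ>\<^sub>s setop_inverse (sv A) \<circ>\<^sub>s sv P) -\<^sub>s sv (\<lambda>z. (1/2) *\<^sub>R P z) = sv L"
proof
  fix z
  have sol: "P x = B z" if "P z = A x" for x
    by (rule B_eqI[symmetric, OF P_mem]) (simp only: A_P that)
  have "B z \<in> {P x |x. P z = A x}"
    unfolding mem_Collect_eq by (intro exI[of _ "B z"] conjI P_id[OF B_mem, symmetric] A_B[symmetric])
  with sol have "{P x |x. P z = A x} = {B z}" by blast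
  moreover have "(sv P \<circ>\<^sub>s setop_inverse (sv A) \<circ>\<^sub>s sv P) z = {P x |x. P z = A x}"
    unfolding setop_comp_def setop_inverse_def sv_def by blast
  ultimately have "(sv P \<circ>\<^sub>s setop_inverse (sv A) \<circ>\<^sub>s sv P) z = {B z}" by simp
  then show "((sv P \<circ>\<^sub>s setop_inverse (sv A) \<circ>\<^sub>s sv P) -\<^sub>s sv (\<lambda>z. (1/2) *\<^sub>R P z)) z = sv L z"
    by (simp add: setop_diff_def sv_def L_def)
qed

lemma L_P: "L (P z) = L z"
  by (simp only: L_def B_P P_id[OF P_mem])

end

theorem lemma2p4:
  fixes R :: "'a::{real_inner,complete_space} \<Rightarrow> 'a"
    and D :: "'a set"
    and P :: "'a \<Rightarrow> 'a"
    and T :: "'a setop"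
  assumes "linear R"
    and "\<forall>x y. norm (R x - R y) \<le> norm (x - y)"
    and "D = Fix R"
    and "P = orth_proj (D\<^sup>\<bottom>)"
    and "T = (sv P \<circ>\<^sub>s setop_inverse (sv (\<lambda>x. x - R x)) \<circ>\<^sub>s sv P) -\<^sub>s sv (\<lambda>z. (1/2) *\<^sub>R P z)"
  shows "(closed (range (\<lambda>x. x - R x)) \<longleftrightarrow> range (\<lambda>x. x - R x) = D\<^sup>\<bottom>)
    \<and> (closed (range (\<lambda>x. x - R x)) \<longrightarrow>
           range (adjoint (\<lambda>x. x - R x)) = D\<^sup>\<bottom>
         \<and> (\<exists>L. T = sv L \<and> linear L \<and> continuous_on UNIV L)
         \<and> monotone_setop T
         \<and> maximally_monotone_setop T
         \<and> setop_range T \<subseteq> D\<^sup>\<bottom>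
         \<and> (sv P \<circ>\<^sub>s T = T \<and> T \<circ>\<^sub>s sv P = T))"
proof -
  interpret linear_nonexpansive R
  proof (rule linear_nonexpansive.intro)
    show "norm (R x) \<le> norm x" for x
      using assms(2)[rule_format, of x 0] linear_0[OF assms(1)] by simp
  qed (rule assms(1))
  have main: "range (adjoint A) = D\<^sup>\<bottom>
         \<and> (\<exists>L. T = sv L \<and> linear L \<and> continuous_on UNIV L)
         \<and> monotone_setop T
         \<and> maximally_monotone_setop T
         \<and> setop_range T \<subseteq> D\<^sup>\<bottom>
         \<and> (sv P \<circ>\<^sub>s T = T \<and> T \<circ>\<^sub>s sv P = T)" if "closed (range A)"
  proof -
    interpret linear_nonexpansive_closed_range R
      using that closed_range_iff by unfold_locales simp
    have T: "T = sv L"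
      unfolding assms(3-5) by (rule setop_eq_L)
    have "range (adjoint A) = D\<^sup>\<bottom>"
      unfolding assms(3) by (rule range_adjoint_A)
    moreover have "linear L \<and> continuous_on UNIV L"
      using linear_L linear_continuous_on[OF bounded_linear_L] by blast
    moreover have "monotone_setop T" "maximally_monotone_setop T"
      unfolding T
      by (rule monotone_sv_linear[OF linear_L L_monotone]
          maximally_monotone_sv_linear[OF linear_L L_monotone])+
    moreover have "setop_range T \<subseteq> D\<^sup>\<bottom>"
      using L_mem by (auto simp: T assms(3) setop_range_def sv_def)
    \<comment> \<open>On the left P fixes the values of \<open>L\<close>; on the right both summands
      of \<open>L\<close> absorb P.\<close>
    moreover have "sv P \<circ>\<^sub>s T = T" "T \<circ>\<^sub>s sv P = T"
      unfolding T assms(3,4) setop_comp_def sv_def by (simp_all add: P_id[OF L_mem] L_P)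
    ultimately show ?thesis using T by blast
  qed
  then show ?thesis
    using closed_range_iff unfolding assms(3) by blast
qed

end
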